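(* For every fixed integer $k\ge2$ and every $\epsilon>0$ there exist a \textsc{(1,2)-TSP} instance $I$ and a $k$-optimal tour $T$ of $I$ with $c(T)\ge\left(\frac{11}{10}-\epsilon\right)\mathrm{OPT}(I)$. Consequently the approximation ratio of the $k$-Opt algorithm for \textsc{(1,2)-TSP} is at least $\frac{11}{10}$.
   Context: A \textsc{(1,2)-TSP} instance is a complete graph $K_n$ with edge costs in $\{1,2\}$. A tour is a Hamiltonian cycle, with cost $c(T)=\sum_{e\in T}c(e)$; $\mathrm{OPT}(I)$ is the minimum tour cost. A $k$-move replaces at most $k$ edges of a tour by other edges so that the result is again a tour; it is improving if the new tour is strictly shorter. A tour is $k$-optimal if no improving $k$-move exists; the $k$-Opt algorithm (start with an arbitrary tour and perform improving $k$-moves until none exists) can output exactly the $k$-optimal tours. *)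

theory Defs
  imports Complex_Main
begin

definition tsp12 :: "nat \<Rightarrow> (nat set \<Rightarrow> nat) \<Rightarrow> bool" where
  "tsp12 n c \<longleftrightarrow> (\<forall>i<n. \<forall>j<n. i \<noteq> j \<longrightarrow> c {i, j} \<in> {1, 2})"

definition cycle_edges :: "nat \<Rightarrow> (nat \<Rightarrow> nat) \<Rightarrow> nat set set" where
  "cycle_edges n p = {{p i, p (Suc i mod n)} | i. i < n}"

definition is_tour :: "nat \<Rightarrow> nat set set \<Rightarrow> bool" where
  "is_tour n T \<longleftrightarrow> 3 \<le> n \<and> (\<exists>p. bij_betw p {..<n} {..<n} \<and> T = cycle_edges n p)"

definition tour_cost :: "(nat set \<Rightarrow> nat) \<Rightarrow> nat set set \<Rightarrow> nat" where
  "tour_cost c T = (\<Sum>e\<in>T. c e)"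

definition OPT :: "nat \<Rightarrow> (nat set \<Rightarrow> nat) \<Rightarrow> nat" where
  "OPT n c = Min {tour_cost c T | T. is_tour n T}"

definition k_move :: "nat \<Rightarrow> nat \<Rightarrow> nat set set \<Rightarrow> nat set set \<Rightarrow> bool" where
  "k_move n k T T' \<longleftrightarrow> is_tour n T \<and> is_tour n T' \<and> card (T - T') \<le> k"

definition k_optimal :: "nat \<Rightarrow> (nat set \<Rightarrow> nat) \<Rightarrow> nat \<Rightarrow> nat set set \<Rightarrow> bool" where
  "k_optimal n c k T \<longleftrightarrow> is_tour n T \<and>
     \<not> (\<exists>T'. k_move n k T T' \<and> tour_cost c T' < tour_cost c T)"

end

theory Submission
  imports Defs "HOL-Combinatorics.Cycles"
begin

text \<open>
  Start from disjoint paths on ten vertices, the gadgets, made of edges of cost 1 and joined by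
  edges of cost 2 to the tour \<open>T\<close>. Each gadget gets two further cheap edges (chords): dropping the middle
  edge of the path and adding both chords saves one expensive edge but leaves two 5-cycles.
  The remaining cheap edges, the links, replace one edge of each 5-cycle so as to string the
  5-cycles together. Regarded as edges between gadgets they form a 4-regular
  graph of girth greater than \<open>k\<close>, so at most \<open>k\<close> links form a forest and touch more gadgets than
  there are links. Since every gadget has to lose path edges both for closing its 5-cycles and
  for being touched by a link, no \<open>k\<close>-move gains. Globally there are as many links as 5-cycles,
  and following the links gives a tour of cost close to the number of vertices, whereas \<open>T\<close> has one
  expensive edge per ten vertices.
\<close>

subsection \<open>Four-regular graphs of large girth\<close>

text \<open>A permutation \<^term>\<open>\<rho>\<close> of \<^term>\<open>{..<2 * m}\<close> encodes a 4-regular multigraph on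
  \<^term>\<open>{..<m}\<close>: the edge \<open>b\<close> joins \<^term>\<open>b div 2\<close> to \<^term>\<open>\<rho> b div 2\<close>. Requiring that at most
  \<open>k\<close> edges always span a forest is the same as girth greater than \<open>k\<close>.\<close>

definition ends :: "(nat \<Rightarrow> nat) \<Rightarrow> nat set \<Rightarrow> nat set" where
  "ends \<rho> F = (\<lambda>b. b div 2) ` F \<union> (\<lambda>b. \<rho> b div 2) ` F"

definition sparse :: "nat \<Rightarrow> (nat \<Rightarrow> nat) \<Rightarrow> nat \<Rightarrow> bool" where
  "sparse m \<rho> k \<longleftrightarrow> \<rho> permutes {..<2 * m} \<and>
     (\<forall>F. F \<subseteq> {..<2 * m} \<longrightarrow> F \<noteq> {} \<longrightarrow> card F \<le> k \<longrightarrow> card F < card (ends \<rho> F))"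

lemma ends_Un: "ends \<rho> (A \<union> B) = ends \<rho> A \<union> ends \<rho> B"
  by (auto simp: ends_def)

lemma ends_insert: "ends \<rho> (insert b F) = {b div 2, \<rho> b div 2} \<union> ends \<rho> F"
  by (auto simp: ends_def)

lemma finite_ends: "finite F \<Longrightarrow> finite (ends \<rho> F)"
  by (simp add: ends_def)

lemma flip_bit_nat_less:
  fixes x :: nat
  assumes "x < 2 ^ n" "i < n"
  shows "flip_bit i x < 2 ^ n"
proof -
  have "take_bit n x = x" using assms by (simp add: take_bit_nat_eq_self_iff)
  then have "j < n" if "bit x j" for j
    using that by (metis bit_take_bit_iff)
  then have "take_bit n (flip_bit i x) = flip_bit i x"
    using assms by (intro bit_eqI) (auto simp: bit_simps)
  then show ?thesis by (simp add: take_bit_nat_eq_self_iff)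
qed

lemma flip_bit_flip_bit_nat: "flip_bit i (flip_bit i x) = (x :: nat)"
  by (intro bit_eqI) (auto simp: bit_simps)

text \<open>The degrees sum to twice the number of edges, so with more ends than edges some end has
  degree below two. A loop counts twice, so the edge at \<open>v\<close> is no loop.\<close>

lemma ex_vertex_of_degree_one:
  assumes "finite F" and "card F < card (ends \<rho> F)"
  obtains v where "card {b \<in> F. b div 2 = v} + card {b \<in> F. \<rho> b div 2 = v} = 1"
proof -
  let ?E = "ends \<rho> F"
  let ?d = "\<lambda>v. card {b \<in> F. b div 2 = v} + card {b \<in> F. \<rho> b div 2 = v}"
  have fin: "finite ?E" using assms(1) by (rule finite_ends)
  have "(\<Sum>v\<in>?E. card {b \<in> F. b div 2 = v}) = card F"
    using sum.group[OF assms(1) fin, of "\<lambda>b. b div 2" "\<lambda>_. 1::nat"] by (auto simp: ends_def)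
  moreover have "(\<Sum>v\<in>?E. card {b \<in> F. \<rho> b div 2 = v}) = card F"
    using sum.group[OF assms(1) fin, of "\<lambda>b. \<rho> b div 2" "\<lambda>_. 1::nat"] by (auto simp: ends_def)
  ultimately have tot: "(\<Sum>v\<in>?E. ?d v) = 2 * card F" by (simp add: sum.distrib)
  have "\<exists>v\<in>?E. ?d v < 2"
  proof (rule ccontr)
    assume "\<not> ?thesis"
    then have "(\<Sum>v\<in>?E. 2) \<le> (\<Sum>v\<in>?E. ?d v)" by (intro sum_mono) auto
    with tot assms(2) show False by simp
  qed
  then obtain v where v: "v \<in> ?E" "?d v < 2" by blast
  have "?d v \<noteq> 0" using v(1) assms(1) by (auto simp: ends_def)
  with v(2) have "?d v = 1" by linarith
  then show thesis by (rule that)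
qed

text \<open>A vertex of the lifted graph carries a bit for every edge below, toggled by traversing that
  edge. Hence a closed walk of the lift uses every edge below an even number of times, and its length
  exceeds the girth below.\<close>

definition lift :: "nat \<Rightarrow> (nat \<Rightarrow> nat) \<Rightarrow> nat \<Rightarrow> nat" where
  "lift m \<rho> b = (if b < 2 * (m * 2 ^ (2 * m))
     then \<rho> (b mod (2 * m)) + 2 * m * flip_bit (b mod (2 * m)) (b div (2 * m)) else b)"

lemma div_mod_mult_add:
  assumes "v < (m::nat)" shows "(v + m * x) div m = x" "(v + m * x) mod m = v"
  using assms by auto

lemma mult_add_less_mult:
  assumes "v < (n::nat)" "x < y" shows "v + n * x < n * y"
proof -
  have "v + n * x < n * Suc x" using assms by simp
  also have "\<dots> \<le> n * y" using assms by (intro mult_le_mono2) auto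
  finally show ?thesis .
qed

text \<open>Induction on the size of \<open>F\<close>. If \<open>F\<close> has at most one edge over
  each edge below, any edge of \<open>F\<close> is a bridge, because only it toggles its bit.
  Otherwise \<open>F\<close> projects to at most \<open>k\<close> edges, which form a forest, and an
  edge over a leaf edge can be removed.\<close>

lemma sparse_lift:
  assumes "m > 0" "sparse m \<rho> k"
  shows "sparse (m * 2 ^ (2 * m)) (lift m \<rho>) (Suc k)"
proof -
  let ?N = "2 * m" and ?M = "m * 2 ^ (2 * m)" and ?r = "lift m \<rho>"
  have \<rho>: "\<rho> permutes {..<?N}"
    and sp: "\<And>F. F \<subseteq> {..<?N} \<Longrightarrow> F \<noteq> {} \<Longrightarrow> card F \<le> k \<Longrightarrow> card F < card (ends \<rho> F)"
    using assms(2) by (auto simp: sparse_def)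
  have \<rho>_less: "\<rho> b < ?N" if "b < ?N" for b
    using permutes_in_image[OF \<rho>, of b] that by simp
  \<comment> \<open>\<open>\<pi> b\<close> is the edge below \<open>b\<close>, and
    \<open>h b\<close> is the bit vector of its starting vertex. A vertex \<open>v\<close> of the
    lift splits likewise into \<open>v mod m\<close> and \<open>v div m\<close>.\<close>
  define \<pi> where "\<pi> b = b mod ?N" for b
  define h where "h b = b div ?N" for b :: nat
  have \<pi>: "\<pi> b < ?N" for b using assms(1) by (simp add: \<pi>_def)
  have h: "h b < 2 ^ ?N" if "b < 2 * ?M" for b
  proof -
    have "b < 2 ^ ?N * ?N" using that by (simp add: mult_ac)
    then show ?thesis unfolding h_def by (rule less_mult_imp_div_less)
  qed
  have split: "b = \<pi> b + ?N * h b" for b by (simp add: \<pi>_def h_def)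
  have r: "?r b = \<rho> (\<pi> b) + ?N * flip_bit (\<pi> b) (h b)" if "b < 2 * ?M" for b
    using that by (simp add: lift_def \<pi>_def h_def)
  have \<pi>r: "\<pi> (?r b) = \<rho> (\<pi> b)" and hr: "h (?r b) = flip_bit (\<pi> b) (h b)" if "b < 2 * ?M" for b
    using div_mod_mult_add[OF \<rho>_less[OF \<pi>[of b]]] by (simp_all only: \<pi>_def h_def r[OF that])
  have inj: "b = c" if "\<pi> b = \<pi> c" "h b = h c" for b c
    using split that by metis
  have "inj_on ?r {..<2 * ?M}"
  proof (rule inj_onI)
    fix b c assume bc: "b \<in> {..<2 * ?M}" "c \<in> {..<2 * ?M}" and eq: "?r b = ?r c"
    have "\<rho> (\<pi> b) = \<rho> (\<pi> c)" using \<pi>r[of b] \<pi>r[of c] bc eq by simp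
    then have "\<pi> b = \<pi> c" using permutes_inj[OF \<rho>] by (simp add: inj_eq)
    moreover have "flip_bit (\<pi> b) (h b) = flip_bit (\<pi> c) (h c)" using hr[of b] hr[of c] bc eq by simp
    ultimately show "b = c" using inj by (metis flip_bit_flip_bit_nat)
  qed
  moreover have "?r ` {..<2 * ?M} \<subseteq> {..<2 * ?M}"
  proof (rule image_subsetI)
    fix b assume "b \<in> {..<2 * ?M}"
    then have b: "b < 2 * ?M" by simp
    have "?r b < ?N * 2 ^ ?N" unfolding r[OF b]
      by (intro mult_add_less_mult \<rho>_less flip_bit_nat_less \<pi> h b)
    then show "?r b \<in> {..<2 * ?M}" by (simp add: mult_ac)
  qed
  ultimately have "bij_betw ?r {..<2 * ?M} {..<2 * ?M}"
    by (simp add: bij_betw_def endo_inj_surj)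
  then have perm: "?r permutes {..<2 * ?M}"
    by (rule bij_imp_permutes) (simp add: lift_def)
  have div2: "b div 2 = \<pi> b div 2 + m * h b" for b
  proof -
    have "b div 2 = (\<pi> b + 2 * (m * h b)) div 2" by (subst split[of b]) (simp only: mult.assoc)
    then show ?thesis by simp
  qed
  have gm: "b div 2 mod m = \<pi> b div 2" "b div 2 div m = h b" for b
    using div_mod_mult_add[of "\<pi> b div 2" m "h b"] \<pi>[of b] by (simp_all add: div2[of b])
  have "card F < card (ends ?r F)" if "F \<subseteq> {..<2 * ?M}" "F \<noteq> {}" "card F \<le> Suc k" for F
    using that
  proof (induction "card F" arbitrary: F rule: less_induct)
    case less
    have fin: "finite F" using less.prems(1) finite_subset by blast
    have lt: "b < 2 * ?M" if "b \<in> F" for b using less.prems(1) that by auto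
    have IH: "card G < card (ends ?r G)" if "G \<subset> F" "G \<noteq> {}" for G
    proof (rule less.hyps)
      show "card G < card F" using that fin by (simp add: psubset_card_mono)
      then show "card G \<le> Suc k" using less.prems by simp
    qed (use that less.prems in auto)
    show ?case
    proof (cases "inj_on \<pi> F")
      case True
      obtain b where b: "b \<in> F" using less.prems by blast
      let ?P = "\<lambda>v. bit (v div m) (\<pi> b)"
      \<comment> \<open>Only \<open>b\<close> toggles bit \<open>\<pi> b\<close>, so each other edge
        of \<open>F\<close> stays on one side of that bit, while \<open>b\<close> joins the two
        sides.\<close>
      define G where "G = (\<lambda>t. {c \<in> F - {b}. bit (h c) (\<pi> b) = t})"
      have G: "ends ?r (G t) \<subseteq> {v. ?P v = t}" for t
      proof -
        have "?P (c div 2) = t \<and> ?P (?r c div 2) = t" if "c \<in> G t" for c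
        proof -
          have c: "c \<in> F" "c \<noteq> b" "bit (h c) (\<pi> b) = t" using that by (auto simp: G_def)
          then have "\<pi> c \<noteq> \<pi> b" using True b by (auto dest: inj_onD)
          then show ?thesis using c hr[OF lt[OF c(1)]] by (auto simp: gm bit_simps)
        qed
        then show ?thesis by (auto simp: ends_def)
      qed
      obtain e where e: "\<And>t. e t \<in> {b div 2, ?r b div 2}" "\<And>t. ?P (e t) = t"
      proof -
        have "?P (b div 2) \<noteq> ?P (?r b div 2)" using hr[OF lt[OF b]] by (auto simp: gm bit_simps)
        then have "\<exists>e. \<forall>t. e t \<in> {b div 2, ?r b div 2} \<and> ?P (e t) = t"
          by (intro choice) auto
        then show thesis using that by blast
      qed
      \<comment> \<open>Adding the end of \<open>b\<close> on side \<open>t\<close> keeps the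
        inequality strict even when \<open>G t\<close> is empty.\<close>
      let ?S = "\<lambda>t. insert (e t) (ends ?r (G t))"
      have finG: "finite (G t)" for t using fin by (simp add: G_def)
      have big: "card (G t) < card (?S t)" for t
      proof (cases "G t = {}")
        case True then show ?thesis by (simp add: ends_def)
      next
        case False
        have "card (G t) < card (ends ?r (G t))" using False b by (intro IH) (auto simp: G_def)
        also have "\<dots> \<le> card (?S t)" using finG by (intro card_mono) (auto simp: finite_ends)
        finally show ?thesis .
      qed
      have F: "F = insert b (G True \<union> G False)" using b by (auto simp: G_def)
      have "card F = Suc (card (G True \<union> G False))"
        by (subst F, rule card_insert_disjoint) (auto simp: finG, auto simp: G_def)
      also have "card (G True \<union> G False) = card (G True) + card (G False)"
        by (rule card_Un_disjoint) (auto simp: finG, auto simp: G_def)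
      finally have "card F < card (?S True) + card (?S False)" using big[of True] big[of False] by linarith
      also have "\<dots> = card (?S True \<union> ?S False)"
      proof (rule card_Un_disjoint[symmetric])
        have "?S t \<subseteq> {v. ?P v = t}" for t using G[of t] e(2)[of t] by auto
        from this[of True] this[of False] show "?S True \<inter> ?S False = {}" by blast
      qed (auto simp: finG finite_ends)
      also have "\<dots> \<le> card (ends ?r F)"
      proof (rule card_mono)
        show "?S True \<union> ?S False \<subseteq> ends ?r F"
          using e(1)[of True] e(1)[of False] by (subst F) (auto simp: ends_insert ends_Un)
      qed (simp add: fin finite_ends)
      finally show ?thesis .
    next
      case False
      \<comment> \<open>Two edges of \<open>F\<close> share their projection, so at most
        \<open>k\<close> edges remain below and the hypothesis on \<open>\<rho>\<close>
        applies.\<close>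
      have "card (\<pi> ` F) < card F"
        using False fin by (metis card_image_le eq_card_imp_inj_on le_neq_implies_less)
      then have "card (\<pi> ` F) < card (ends \<rho> (\<pi> ` F))"
        using less.prems \<pi> by (intro sp) auto
      then obtain v where
        v: "card {b \<in> \<pi> ` F. b div 2 = v} + card {b \<in> \<pi> ` F. \<rho> b div 2 = v} = 1"
        using ex_vertex_of_degree_one[of "\<pi> ` F" \<rho>] fin by blast
      \<comment> \<open>\<open>b\<close> lies over the only edge at the leaf \<open>v\<close>, and
        \<open>w\<close> is its end over \<open>v\<close>. Another edge of \<open>F\<close> at
        \<open>w\<close> would have the same projection and the same bit vector at that end, hence
        equal \<open>b\<close>.\<close>
      obtain b w where b: "b \<in> F" and w: "w \<in> {b div 2, ?r b div 2}" "w \<notin> ends ?r (F - {b})"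
      proof (cases "card {b \<in> \<pi> ` F. b div 2 = v} = 1")
        case True
        then have zero: "{b \<in> \<pi> ` F. \<rho> b div 2 = v} = {}" using v fin by simp
        from True obtain b' where b': "{b \<in> \<pi> ` F. b div 2 = v} = {b'}" by (rule card_1_singletonE)
        then have "b' \<in> \<pi> ` F" "b' div 2 = v" by auto
        then obtain b where b: "b \<in> F" "\<pi> b = b'" "\<pi> b div 2 = v" by auto
        have "b div 2 \<notin> ends ?r (F - {b})"
        proof
          assume "b div 2 \<in> ends ?r (F - {b})"
          then obtain c where c: "c \<in> F" "c \<noteq> b" "b div 2 = c div 2 \<or> b div 2 = ?r c div 2"
            by (auto simp: ends_def)
          from c(3) show False
          proof
            assume "b div 2 = c div 2"
            then have "\<pi> c div 2 = v" "h c = h b" using gm[of b] gm[of c] b by simp_all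
            moreover from this have "\<pi> c \<in> {b'}" unfolding b'[symmetric] using c(1) by simp
            ultimately show False using inj[of c b] b(2) c(2) by simp
          next
            assume "b div 2 = ?r c div 2"
            then have "\<rho> (\<pi> c) div 2 = v" using gm[of b] gm[of "?r c"] b \<pi>r[OF lt[OF c(1)]] by simp
            with zero c(1) show False by blast
          qed
        qed
        then show thesis using that b(1) by blast
      next
        case False
        then have zero: "{b \<in> \<pi> ` F. b div 2 = v} = {}" and one: "card {b \<in> \<pi> ` F. \<rho> b div 2 = v} = 1"
          using v fin by (auto simp: add_is_1)
        from one obtain b' where b': "{b \<in> \<pi> ` F. \<rho> b div 2 = v} = {b'}" by (rule card_1_singletonE)
        then have "b' \<in> \<pi> ` F" "\<rho> b' div 2 = v" by auto
        then obtain b where b: "b \<in> F" "\<pi> b = b'" "\<rho> (\<pi> b) div 2 = v" by auto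
        have "?r b div 2 \<notin> ends ?r (F - {b})"
        proof
          assume "?r b div 2 \<in> ends ?r (F - {b})"
          then obtain c where c: "c \<in> F" "c \<noteq> b" "?r b div 2 = c div 2 \<or> ?r b div 2 = ?r c div 2"
            by (auto simp: ends_def)
          note rb = \<pi>r[OF lt[OF b(1)]] hr[OF lt[OF b(1)]] and rc = \<pi>r[OF lt[OF c(1)]] hr[OF lt[OF c(1)]]
          from c(3) show False
          proof
            assume "?r b div 2 = c div 2"
            then have "\<pi> c div 2 = v" using gm[of "?r b"] gm[of c] b rb by simp
            with zero c(1) show False by blast
          next
            assume "?r b div 2 = ?r c div 2"
            then have "\<rho> (\<pi> c) div 2 = v" "flip_bit (\<pi> c) (h c) = flip_bit (\<pi> b) (h b)"
              using gm[of "?r b"] gm[of "?r c"] b rb rc by simp_all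
            moreover from this have "\<pi> c \<in> {b'}" unfolding b'[symmetric] using c(1) by simp
            ultimately show False
              using inj[of c b] b(2) c(2) flip_bit_flip_bit_nat by (metis singletonD)
          qed
        qed
        then show thesis using that b(1) by blast
      qed
      \<comment> \<open>The induction hypothesis needs a nonempty set; a singleton \<open>F\<close>
        belongs to the injective case.\<close>
      have "F - {b} \<noteq> {}"
      proof
        assume "F - {b} = {}"
        then have "inj_on \<pi> F" by (auto simp: inj_on_def)
        with False show False by simp
      qed
      then have "card (F - {b}) < card (ends ?r (F - {b}))" using b by (intro IH) auto
      then have "card F < card (insert w (ends ?r (F - {b})))"
        using w(2) b fin by (simp add: finite_ends card_insert_disjoint card_Diff_singleton)
      also have "\<dots> \<le> card (ends ?r F)"
        using w(1) b fin by (intro card_mono finite_ends) (auto simp: ends_def)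
      finally show ?thesis .
    qed
  qed
  with perm show ?thesis by (simp add: sparse_def)
qed

lemma ex_sparse: "\<exists>m>0. \<exists>\<rho>. sparse m \<rho> k"
proof (induction k)
  case 0
  \<comment> \<open>For \<open>k = 0\<close> the condition is vacuous, since a nonempty finite set
    has positive cardinality.\<close>
  have "sparse 1 id 0"
    by (auto simp: sparse_def permutes_id finite_subset)
  then show ?case by blast
next
  case (Suc k)
  then obtain m \<rho> where m: "m > 0" and "sparse m \<rho> k" by blast
  then have "sparse (m * 2 ^ (2 * m)) (lift m \<rho>) (Suc k)" by (rule sparse_lift)
  moreover have "0 < m * 2 ^ (2 * m)" using m by simp
  ultimately show ?case by blast
qed

subsection \<open>Enumerating the orbits of a permutation\<close>

text \<open>The edge \<open>\<rho> b\<close> starts at the vertex where the edge \<open>b\<close>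
  ends, so an orbit is a closed walk. Every end of its edges is also a start, leaving no more
  vertices than edges.\<close>

lemma sparse_no_short_orbit:
  assumes "sparse m \<rho> k" and b: "b < 2 * m" and "0 < i" "i \<le> k"
  shows "(\<rho> ^^ i) b \<noteq> b"
proof
  assume eq: "(\<rho> ^^ i) b = b"
  have \<rho>: "\<rho> permutes {..<2 * m}" using assms(1) by (simp add: sparse_def)
  let ?F = "(\<lambda>j. (\<rho> ^^ j) b) ` {..<i}"
  have "(\<rho> ^^ j) b \<in> {..<2 * m}" for j
    by (induction j) (use b permutes_in_image[OF \<rho>] in auto)
  then have sub: "?F \<subseteq> {..<2 * m}" by blast
  have "card ?F \<le> i" using card_image_le[of "{..<i}"] by simp
  then have less: "card ?F < card (ends \<rho> ?F)"
    using assms sub unfolding sparse_def by auto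
  have "ends \<rho> ?F \<subseteq> (\<lambda>b. b div 2) ` ?F"
  proof -
    have "\<rho> ((\<rho> ^^ j) b) \<in> ?F" if "j < i" for j
    proof (cases "Suc j = i")
      case True
      then have "\<rho> ((\<rho> ^^ j) b) = (\<rho> ^^ 0) b" using eq by auto
      then show ?thesis using assms(3) by blast
    next
      case False
      then have "Suc j \<in> {..<i}" using that by simp
      then have "(\<rho> ^^ Suc j) b \<in> ?F" by (rule imageI)
      then show ?thesis by simp
    qed
    then show ?thesis by (auto simp: ends_def)
  qed
  then have "card (ends \<rho> ?F) \<le> card ((\<lambda>b. b div 2) ` ?F)" by (intro card_mono) simp_all
  also have "\<dots> \<le> card ?F" by (intro card_image_le) simp
  finally show False using less by simp
qed

text \<open>The last index always counts as a break.\<close>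

definition breaks :: "('a \<Rightarrow> 'a) \<Rightarrow> 'a list \<Rightarrow> nat set" where
  "breaks f xs = {j. j < length xs \<and> (Suc j < length xs \<longrightarrow> xs ! Suc j \<noteq> f (xs ! j))}"

lemma finite_breaks: "finite (breaks f xs)"
  by (simp add: breaks_def)

text \<open>The junction costs nothing extra: the last index of \<open>xs\<close> is already a break
  of \<open>xs\<close>.\<close>

lemma breaks_append:
  "breaks f (xs @ ys) \<subseteq> breaks f xs \<union> (\<lambda>j. length xs + j) ` breaks f ys"
proof
  fix j assume j: "j \<in> breaks f (xs @ ys)"
  show "j \<in> breaks f xs \<union> (\<lambda>j. length xs + j) ` breaks f ys"
  proof (cases "j < length xs")
    case True
    then show ?thesis using j by (auto simp: breaks_def nth_append)
  next
    case False
    then obtain i where "j = length xs + i" using le_Suc_ex not_le by blast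
    moreover from this have "i \<in> breaks f ys" using j by (auto simp: breaks_def nth_append)
    ultimately show ?thesis by blast
  qed
qed

text \<open>The cycles of \<open>f\<close> are listed one after another, each in cyclic order. Each
  contributes at most the break at its last index and has more than \<open>k\<close> elements to pay
  for it.\<close>

lemma ex_enumeration_few_breaks:
  assumes "f permutes S" "finite S"
    and "\<And>x i. x \<in> S \<Longrightarrow> 0 < i \<Longrightarrow> i \<le> k \<Longrightarrow> (f ^^ i) x \<noteq> x"
    and "A \<subseteq> S" "f ` A \<subseteq> A"
  shows "\<exists>xs. distinct xs \<and> set xs = A \<and> k * card (breaks f xs) \<le> card A"
  using assms(4,5)
proof (induction "card A" arbitrary: A rule: less_induct)
  case less
  have p: "permutation f" using assms(1,2) permutation_permutes by blast
  have finA: "finite A" using less.prems assms(2) finite_subset by blast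
  show ?case
  proof (cases "A = {}")
    case True
    then show ?thesis by (auto simp: breaks_def)
  next
    case False
    then obtain x where x: "x \<in> A" by blast
    define ys where "ys = support f x"
    have "(f ^^ i) x \<in> A" for i by (induction i) (use x less.prems in auto)
    then have ysA: "set ys \<subseteq> A" by (auto simp: ys_def)
    have "x \<in> set ys" using support_set[OF p, of x] unfolding ys_def by (metis funpow_0 rangeI)
    have dist: "distinct ys" unfolding ys_def by (rule cycle_of_permutation[OF p])
    \<comment> \<open>The rest of \<open>A\<close> stays invariant: an element mapped into the cycle
      already lies on it.\<close>
    have notin: "f y \<notin> set ys" if "y \<in> A - set ys" for y
    proof
      assume "f y \<in> set ys"
      then obtain i where i: "i < length ys" "f y = (f ^^ i) x" by (auto simp: ys_def)
      \<comment> \<open>A positive exponent is needed to cancel one \<open>f\<close>; exponent 0 is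
        replaced by the full period.\<close>
      have "\<exists>j. (f ^^ Suc j) x = (f ^^ i) x"
      proof (cases i)
        case 0
        then show ?thesis
          using least_power_of_permutation[OF p, of x] by (metis Suc_pred funpow_0)
      qed blast
      then obtain j where "(f ^^ Suc j) x = f y" using i by auto
      then have "f y = f ((f ^^ j) x)" by simp
      then have "y = (f ^^ j) x" using permutes_inj[OF assms(1)] by (simp add: inj_eq)
      then show False using that support_set[OF p, of x] unfolding ys_def by blast
    qed
    have "card (A - set ys) < card A"
      using \<open>x \<in> set ys\<close> x finA by (intro psubset_card_mono) auto
    moreover have "f ` (A - set ys) \<subseteq> A - set ys" using notin less.prems by blast
    ultimately obtain zs where zs: "distinct zs" "set zs = A - set ys"
        "k * card (breaks f zs) \<le> card (A - set ys)"
      using less.hyps[of "A - set ys"] less.prems by auto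
    have len: "length ys = least_power f x" by (simp add: ys_def)
    have "k < length ys"
      using least_power_of_permutation[OF p, of x] assms(3)[of x "least_power f x"] x less.prems
      unfolding len by (meson not_le subsetD)
    have "breaks f ys \<subseteq> {length ys - 1}"
      by (auto simp: breaks_def ys_def)
    then have one: "card (breaks f ys) \<le> 1" using card_mono[of "{length ys - 1}" "breaks f ys"] by simp
    have "card (breaks f (ys @ zs)) \<le> card (breaks f ys \<union> (\<lambda>j. length ys + j) ` breaks f zs)"
      by (intro card_mono breaks_append) (simp add: finite_breaks)
    also have "\<dots> \<le> card (breaks f ys) + card ((\<lambda>j. length ys + j) ` breaks f zs)"
      by (rule card_Un_le)
    also have "\<dots> \<le> 1 + card (breaks f zs)"
      by (intro add_mono one card_image_le finite_breaks)
    finally have "card (breaks f (ys @ zs)) \<le> 1 + card (breaks f zs)" .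
    then have "k * card (breaks f (ys @ zs)) \<le> k + k * card (breaks f zs)"
      by (metis mult_le_mono2 mult_Suc_right plus_1_eq_Suc)
    also have "\<dots> \<le> card (set ys) + card (A - set ys)"
      using zs(3) \<open>k < length ys\<close> dist by (simp add: distinct_card)
    also have "\<dots> = card A"
      using ysA finA card_Un_disjoint[of "set ys" "A - set ys"] by (simp add: Un_absorb1)
    finally have "k * card (breaks f (ys @ zs)) \<le> card A" .
    moreover have "distinct (ys @ zs)" "set (ys @ zs) = A" using dist zs ysA by auto
    ultimately show ?thesis by blast
  qed
qed

subsection \<open>Tours\<close>

lemma cycle_edges_image: "cycle_edges n p = (\<lambda>i. {p i, p (Suc i mod n)}) ` {..<n}"
  by (auto simp: cycle_edges_def)

lemma Suc_mod_inj:
  assumes "i < n" "j < n" "Suc i mod n = Suc j mod n"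
  shows "i = j"
  using assms by (auto simp: mod_Suc split: if_splits)

lemma tour_degree_le_2:
  assumes "is_tour n T"
  obtains x y where "\<And>a. {v, a} \<in> T \<Longrightarrow> a = x \<or> a = y"
proof -
  obtain p where p: "bij_betw p {..<n} {..<n}" "T = cycle_edges n p"
    using assms by (auto simp: is_tour_def)
  have inj: "i = j" if "i < n" "j < n" "p i = p j" for i j
    using p(1) that by (auto simp: bij_betw_def inj_on_def)
  \<comment> \<open>The neighbours of \<open>v\<close> on the cycle. If \<open>v\<close> is no
    vertex these values are arbitrary, but then no edge contains \<open>v\<close>.\<close>
  define nxt where "nxt = p (Suc (THE i. i < n \<and> p i = v) mod n)"
  define prv where "prv = p (THE i. i < n \<and> p (Suc i mod n) = v)"
  have "a = nxt \<or> a = prv" if va: "{v, a} \<in> T" for a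
  proof -
    obtain i where i: "i < n" "{v, a} = {p i, p (Suc i mod n)}"
      using va unfolding p(2) cycle_edges_image by blast
    then consider "v = p i" "a = p (Suc i mod n)" | "a = p i" "v = p (Suc i mod n)"
      by (auto simp: doubleton_eq_iff)
    then show ?thesis
    proof cases
      case 1
      have "(THE i. i < n \<and> p i = v) = i" using i 1 inj by (intro the_equality) auto
      then show ?thesis using 1 by (simp add: nxt_def)
    next
      case 2
      have "(THE i. i < n \<and> p (Suc i mod n) = v) = i"
      proof (intro the_equality conjI)
        fix j assume "j < n \<and> p (Suc j mod n) = v"
        then show "j = i" using i(1) 2 inj[of "Suc j mod n" "Suc i mod n"] Suc_mod_inj[of j n i] by simp
      qed (use i 2 in auto)
      then show ?thesis using 2 by (simp add: prv_def)
    qed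
  qed
  then show thesis by (rule that)
qed

lemma tour_three_neighbours:
  assumes "is_tour n T" "{v, a} \<in> T" "{v, b} \<in> T" "{v, c} \<in> T"
  shows "a = b \<or> a = c \<or> b = c"
  using tour_degree_le_2[OF assms(1), of v] assms(2-4) by metis

text \<open>Connectedness: otherwise the walk along the cycle from a vertex of \<open>S\<close>
  would never leave \<open>S\<close>, yet it visits everything.\<close>

lemma tour_leaves_subset:
  assumes "is_tour n T" "S \<noteq> {}" "S \<subset> {..<n}"
  obtains v w where "v \<in> S" "w \<notin> S" "{v, w} \<in> T"
proof (rule ccontr)
  note out = that
  assume no: "\<not> thesis"
  obtain p where p: "bij_betw p {..<n} {..<n}" "T = cycle_edges n p" and n: "n \<ge> 3"
    using assms by (auto simp: is_tour_def)
  have surj: "p ` {..<n} = {..<n}" using p(1) by (simp add: bij_betw_def)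
  obtain v where "v \<in> S" using assms by blast
  then have "v \<in> p ` {..<n}" unfolding surj using assms(3) by blast
  then obtain i where i: "i < n" "p i \<in> S" using \<open>v \<in> S\<close> by blast
  have "p ((i + j) mod n) \<in> S" for j
  proof (induction j)
    case 0 show ?case using i by simp
  next
    case (Suc j)
    have "(i + j) mod n < n" using n by simp
    then have "{p ((i + j) mod n), p (Suc ((i + j) mod n) mod n)} \<in> T"
      unfolding p(2) cycle_edges_image by blast
    then have "p (Suc ((i + j) mod n) mod n) \<in> S" using Suc out no by blast
    then show ?case by (simp add: mod_simps)
  qed
  note all = this
  \<comment> \<open>Going \<open>n - i + l\<close> steps from position \<open>i\<close> wraps around
    to position \<open>l\<close>.\<close>
  have "p l \<in> S" if "l < n" for l
    using all[of "n - i + l"] i(1) that by (simp add: add.assoc[symmetric])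
  then have "p ` {..<n} \<subseteq> S" by blast
  then have "{..<n} \<subseteq> S" unfolding surj .
  then show False using assms(3) by blast
qed

lemma tour_card:
  assumes "is_tour n T" shows "card T = n"
proof -
  obtain p where p: "bij_betw p {..<n} {..<n}" "T = cycle_edges n p" and n: "n \<ge> 3"
    using assms by (auto simp: is_tour_def)
  have inj: "i = j" if "i < n" "j < n" "p i = p j" for i j
    using p(1) that by (auto simp: bij_betw_def inj_on_def)
  \<comment> \<open>Two positions with the same edge would be cyclic successors of each other, which
    \<open>n \<ge> 3\<close> excludes.\<close>
  have "inj_on (\<lambda>i. {p i, p (Suc i mod n)}) {..<n}"
  proof (rule inj_onI, rule ccontr)
    fix i j assume ij: "i \<in> {..<n}" "j \<in> {..<n}" "{p i, p (Suc i mod n)} = {p j, p (Suc j mod n)}" "i \<noteq> j"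
    have "p i \<noteq> p j" using inj ij by auto
    then have "p i = p (Suc j mod n)" "p j = p (Suc i mod n)" using ij(3) by (auto simp: doubleton_eq_iff)
    then have "i = Suc j mod n" "j = Suc i mod n" using inj ij(1,2) n by auto
    moreover have "Suc l mod n = (if Suc l = n then 0 else Suc l)" if "l < n" for l
      using that by auto
    ultimately show False using n ij(1,2) by (auto split: if_splits)
  qed
  then show ?thesis unfolding p(2) cycle_edges_image by (simp add: card_image)
qed

lemma tour_finite: "is_tour n T \<Longrightarrow> finite T"
  by (auto simp: is_tour_def cycle_edges_image)

lemma OPT_le:
  assumes "is_tour n T" shows "OPT n c \<le> tour_cost c T"
proof -
  have "{T. is_tour n T} \<subseteq> Pow (Pow {..<n})"
    by (force simp: is_tour_def cycle_edges_image bij_betw_def)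
  then have "finite {T. is_tour n T}" by (rule finite_subset) simp
  then have "finite {tour_cost c T | T. is_tour n T}" by (simp add: setcompr_eq_image)
  then show ?thesis unfolding OPT_def using assms by (intro Min_le) auto
qed

subsection \<open>The instance\<close>

text \<open>Gadget \<open>g\<close> consists of the vertices \<open>10 * g, \<dots>, 10 * g + 9\<close>, split into the blocks
  \<^term>\<open>2 * g\<close> and \<^term>\<open>2 * g + 1\<close> of five vertices each. In a block the path edge between entry
  and exit is the one that the optimal tour drops. The two blocks are
  mirror images of each other (up to swapping entry and exit), which is why \<open>arm\<close> depends on the parity:
  no path edge at an entry or exit touches the inner end of a chord.\<close>

definition arm :: "nat \<Rightarrow> nat" where
  "arm b = (if even b then 1 else 2)"

definition entry :: "nat \<Rightarrow> nat" where
  "entry b = 5 * b + arm b"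

definition exit :: "nat \<Rightarrow> nat" where
  "exit b = 5 * b + arm b + 1"

definition path_edges :: "nat \<Rightarrow> nat set set" where
  "path_edges m = (\<lambda>(g, r). {10 * g + r, 10 * g + r + 1}) ` ({..<m} \<times> {..<9})"

definition chords :: "nat \<Rightarrow> nat set set" where
  "chords m = (\<lambda>b. {5 * b, 5 * b + 4}) ` {..<2 * m}"

definition link :: "(nat \<Rightarrow> nat) \<Rightarrow> nat \<Rightarrow> nat set" where
  "link \<rho> b = {exit b, entry (\<rho> b)}"

definition cheap :: "nat \<Rightarrow> (nat \<Rightarrow> nat) \<Rightarrow> nat set set" where
  "cheap m \<rho> = path_edges m \<union> chords m \<union> link \<rho> ` {..<2 * m}"

definition cost :: "nat \<Rightarrow> (nat \<Rightarrow> nat) \<Rightarrow> nat set \<Rightarrow> nat" where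
  "cost m \<rho> e = (if e \<in> cheap m \<rho> then 1 else 2)"

text \<open>Turns comparing costs of tours into counting their cheap edges.\<close>

lemma tour_cost_eq:
  assumes "is_tour n T" shows "tour_cost (cost m \<rho>) T + card (T \<inter> cheap m \<rho>) = 2 * n"
proof -
  have fin: "finite T" using assms by (rule tour_finite)
  have "tour_cost (cost m \<rho>) T + card (T \<inter> cheap m \<rho>) =
      (\<Sum>e\<in>T. cost m \<rho> e + of_bool (e \<in> cheap m \<rho>))"
    using fin by (simp add: tour_cost_def sum.distrib Int_def)
  also have "\<dots> = (\<Sum>e\<in>T. 2)" by (intro sum.cong) (auto simp: cost_def)
  finally show ?thesis using tour_card[OF assms] by simp
qed

text \<open>These residues tell exits from entries and keep links away from the last vertex of a
  gadget.\<close>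

lemma mod_10_exit: "exit b mod 10 \<in> {2, 8}" and mod_10_entry: "entry b mod 10 \<in> {1, 7}"
proof -
  have "exit b mod 10 \<in> {2, 8} \<and> entry b mod 10 \<in> {1, 7}"
  proof (cases "even b")
    case True
    then obtain c where "b = 2 * c" by blast
    then show ?thesis by (simp add: exit_def entry_def arm_def) presburger
  next
    case False
    then obtain c where "b = 2 * c + 1" by (rule oddE)
    then show ?thesis by (simp add: exit_def entry_def arm_def mod_Suc)
  qed
  then show "exit b mod 10 \<in> {2, 8}" "entry b mod 10 \<in> {1, 7}" by auto
qed

lemma div_5_exit: "exit b div 5 = b"
  by (auto simp: exit_def arm_def)

text \<open>With the next lemma: a link can coincide with a path edge only if \<open>\<rho>\<close>
  fixes its block.\<close>

lemma entry_eq_pred_exit: "Suc (entry c) = exit b \<Longrightarrow> c = b"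
  unfolding entry_def exit_def arm_def by presburger

lemma entry_neq_Suc_exit: "entry c \<noteq> Suc (exit b)"
  unfolding entry_def exit_def arm_def by presburger

text \<open>A fixed point would be a loop, one edge with a single end.\<close>

lemma sparse_fixpoint_free:
  assumes "sparse m \<rho> k" "k > 0" "b < 2 * m" shows "\<rho> b \<noteq> b"
proof
  assume "\<rho> b = b"
  moreover have "card {b} < card (ends \<rho> {b})"
    using assms unfolding sparse_def by (elim conjE allE[of _ "{b}"]) auto
  ultimately show False by (simp add: ends_def)
qed

section \<open>Counting cheap edges gadget by gadget\<close>

lemma sum_lessThan_double:
  "(\<Sum>b<2 * m. f b) = (\<Sum>g<m. f (2 * g) + f (2 * g + 1 :: nat) :: nat)"
  by (induction m) auto

text \<open>A gadget pays with its missing path edges for its chords and for being touched by links. A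
  chord needs a missing path edge in its block (otherwise a 5-cycle closes) and one at its inner end
  (degree two); the middle edge \<open>r = 4\<close> serves the second purpose for both chords, but is in no block.\<close>

lemma gadget_bound:
  fixes g :: nat
  assumes T: "is_tour (10 * m) T" and g: "g < m"
    and \<rho>: "\<And>b. b < 2 * m \<Longrightarrow> \<rho> b \<noteq> b"
  defines "J \<equiv> {b. b < 2 * m \<and> link \<rho> b \<in> T}"
  shows "of_bool ({5 * (2 * g), 5 * (2 * g) + 4} \<in> T) + of_bool ({5 * (2 * g + 1), 5 * (2 * g + 1) + 4} \<in> T)
      + of_bool (g \<in> ends \<rho> J)
    \<le> (\<Sum>r<9. of_bool ({10 * g + r, 10 * g + r + 1} \<notin> T) :: nat)"
proof -
  define P where "P r \<longleftrightarrow> {10 * g + r, 10 * g + r + 1} \<in> T" for r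
  define x where "x r = (of_bool (\<not> P r) :: nat)" for r
  let ?C1 = "{5 * (2 * g), 5 * (2 * g) + 4} \<in> T" and ?C2 = "{5 * (2 * g + 1), 5 * (2 * g + 1) + 4} \<in> T"
  \<comment> \<open>A vertex with a further tour edge cannot keep both of its path edges.\<close>
  have deg: "\<not> (P r \<and> P (Suc r))" if "{10 * g + Suc r, a} \<in> T" "a \<noteq> 10 * g + r" "a \<noteq> 10 * g + r + 2" for r a
    using tour_three_neighbours[OF T, of "10 * g + Suc r" a "10 * g + r" "10 * g + r + 2"] that
    by (auto simp: P_def insert_commute)
  \<comment> \<open>With all four path edges of block \<open>s\<close>, its chord would close a
    5-cycle that the tour can never leave.\<close>
  have cyc: "\<exists>r<4. \<not> P (5 * s + r)" if s: "s \<le> 1" and C: "{10 * g + 5 * s, 10 * g + 5 * s + 4} \<in> T" for s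
  proof (rule ccontr)
    define v where "v = 10 * g + 5 * s"
    assume "\<not> ?thesis"
    then have e: "{v, v + 1} \<in> T" "{v + 1, v + 2} \<in> T" "{v + 2, v + 3} \<in> T" "{v + 3, v + 4} \<in> T" "{v + 4, v} \<in> T"
      using C by (auto simp: P_def v_def insert_commute numeral_eq_Suc All_less_Suc)
    let ?S = "{v, v + 1, v + 2, v + 3, v + 4}"
    have "?S \<subset> {..<10 * m}"
    proof (rule psubsetI)
      show "?S \<subseteq> {..<10 * m}" using g s by (auto simp: v_def)
      have "card ?S \<le> 5" by (simp add: card_insert_if)
      moreover have "5 < card {..<10 * m}" using g by simp
      ultimately show "?S \<noteq> {..<10 * m}" by (metis not_le)
    qed
    then obtain a w where aw: "a \<in> ?S" "w \<notin> ?S" "{a, w} \<in> T"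
      using tour_leaves_subset[OF T, of ?S] by blast
    then show False
      using e tour_three_neighbours[OF T aw(3), of "v + 1" "v + 4"]
        tour_three_neighbours[OF T aw(3), of v "v + 2"]
        tour_three_neighbours[OF T aw(3), of "v + 1" "v + 3"]
        tour_three_neighbours[OF T aw(3), of "v + 2" "v + 4"]
        tour_three_neighbours[OF T aw(3), of "v + 3" v]
      by (auto simp: insert_commute)
  qed
  have C1: "x 3 + x 4 \<ge> 1" "x 0 + x 1 + x 2 + x 3 \<ge> 1" if ?C1
  proof -
    have "\<not> (P 3 \<and> P (Suc 3))" by (rule deg[of _ "10 * g"]) (use that in \<open>auto simp: insert_commute\<close>)
    then show "x 3 + x 4 \<ge> 1" by (auto simp: x_def)
    have "\<exists>r<4. \<not> P (5 * 0 + r)" by (rule cyc) (use that in simp_all)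
    then show "x 0 + x 1 + x 2 + x 3 \<ge> 1"
      by (auto simp: x_def numeral_eq_Suc Ex_less_Suc)
  qed
  have C2: "x 4 + x 5 \<ge> 1" "x 5 + x 6 + x 7 + x 8 \<ge> 1" if ?C2
  proof -
    have "\<not> (P 4 \<and> P (Suc 4))" by (rule deg[of _ "10 * g + 9"]) (use that in \<open>auto simp: algebra_simps\<close>)
    then show "x 4 + x 5 \<ge> 1" by (auto simp: x_def)
    have "\<exists>r<4. \<not> P (5 * 1 + r)" by (rule cyc) (use that in \<open>auto simp: algebra_simps\<close>)
    then show "x 5 + x 6 + x 7 + x 8 \<ge> 1"
      by (auto simp: x_def numeral_eq_Suc Ex_less_Suc)
  qed
  \<comment> \<open>A link ends at offset 1, 2, 7 or 8 and is no path edge, so one of the two path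
    edges there is missing. Edges 3, 4 and 5 do not occur.\<close>
  have W: "x 0 + x 1 + x 2 + x 6 + x 7 + x 8 \<ge> 1" if touched: "g \<in> ends \<rho> J"
  proof -
    obtain b where b: "b \<in> J" "g = b div 2 \<or> g = \<rho> b div 2" using touched by (auto simp: ends_def)
    then have L: "{exit b, entry (\<rho> b)} \<in> T" and ne: "\<rho> b \<noteq> b" using \<rho> by (auto simp: J_def link_def)
    have far: "Suc (entry (\<rho> b)) \<noteq> exit b" "entry (\<rho> b) \<noteq> Suc (exit b)"
      using ne entry_eq_pred_exit entry_neq_Suc_exit by auto
    have "b = 2 * g \<or> b = 2 * g + 1 \<or> \<rho> b = 2 * g \<or> \<rho> b = 2 * g + 1" using b(2) by presburger
    then show ?thesis
    proof (elim disjE)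
      assume "b = 2 * g"
      then have e: "exit b = 10 * g + Suc 1" by (simp add: exit_def arm_def)
      have "\<not> (P 1 \<and> P (Suc 1))" by (rule deg[OF L[unfolded e]]) (use far e in simp_all)
      then show ?thesis by (auto simp: x_def numeral_eq_Suc)
    next
      assume "b = 2 * g + 1"
      then have e: "exit b = 10 * g + Suc 7" by (simp add: exit_def arm_def)
      have "\<not> (P 7 \<and> P (Suc 7))" by (rule deg[OF L[unfolded e]]) (use far e in simp_all)
      then show ?thesis by (auto simp: x_def numeral_eq_Suc)
    next
      assume "\<rho> b = 2 * g"
      then have e: "entry (\<rho> b) = 10 * g + Suc 0" by (simp add: entry_def arm_def)
      have "\<not> (P 0 \<and> P (Suc 0))"
        by (rule deg[OF L[unfolded e insert_commute[of "exit b"]]]) (use far e in simp_all)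
      then show ?thesis by (auto simp: x_def numeral_eq_Suc)
    next
      assume "\<rho> b = 2 * g + 1"
      then have e: "entry (\<rho> b) = 10 * g + Suc 6" by (simp add: entry_def arm_def)
      have "\<not> (P 6 \<and> P (Suc 6))"
        by (rule deg[OF L[unfolded e insert_commute[of "exit b"]]]) (use far e in simp_all)
      then show ?thesis by (auto simp: x_def numeral_eq_Suc)
    qed
  qed
  \<comment> \<open>If the middle edge is present, edges 3 and 5 pay for the chords and
    \<open>W\<close> pays separately for being touched. If it is missing, it pays for being touched,
    and each chord is paid inside its own block.\<close>
  have "of_bool ?C1 + of_bool ?C2 + of_bool (g \<in> ends \<rho> J)
      \<le> x 0 + x 1 + x 2 + x 3 + x 4 + x 5 + x 6 + x 7 + x 8"
  proof (cases "P 4")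
    case True
    then have "x 4 = 0" by (simp add: x_def)
    then show ?thesis using C1 C2 W by (cases ?C1; cases ?C2; cases "g \<in> ends \<rho> J") simp_all
  next
    case False
    then have "x 4 = 1" by (simp add: x_def)
    then show ?thesis using C1 C2 W by (cases ?C1; cases ?C2; cases "g \<in> ends \<rho> J") simp_all
  qed
  also have "\<dots> = (\<Sum>r<9. x r)" by (simp add: numeral_eq_Suc)
  finally show ?thesis unfolding x_def P_def .
qed

text \<open>By sparsity the links of the tour are at most as many as the gadgets they touch. Summing
  \<open>gadget_bound\<close>, chords and links together never exceed the missing path
  edges.\<close>

lemma card_cheap_in_tour_le:
  assumes T: "is_tour (10 * m) T" and sp: "sparse m \<rho> k" and k: "k > 0"
    and J: "card {b. b < 2 * m \<and> link \<rho> b \<in> T} \<le> k"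
  shows "card (T \<inter> cheap m \<rho>) \<le> 9 * m"
proof -
  define J where "J = {b. b < 2 * m \<and> link \<rho> b \<in> T}"
  let ?W = "ends \<rho> J"
  let ?p = "\<lambda>g r. {10 * g + r, 10 * g + r + 1}" and ?c = "\<lambda>b. {5 * b, 5 * b + 4}"
  have \<rho>: "\<rho> permutes {..<2 * m}" using sp by (simp add: sparse_def)
  have finJ: "finite J" and subJ: "J \<subseteq> {..<2 * m}" by (auto simp: J_def)
  have JW: "card J \<le> card ?W"
    using sp J subJ unfolding sparse_def J_def[symmetric] by (cases "J = {}") (auto intro: less_imp_le)
  have W: "?W \<subseteq> {..<m}"
  proof -
    have "b div 2 < m \<and> \<rho> b div 2 < m" if "b \<in> J" for b
      using that subJ permutes_in_image[OF \<rho>, of b] by auto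
    then show ?thesis by (auto simp: ends_def)
  qed
  let ?A = "(\<lambda>(g, r). ?p g r) ` {x \<in> {..<m} \<times> {..<9}. (case x of (g, r) \<Rightarrow> ?p g r \<in> T)}"
  let ?B = "?c ` {b \<in> {..<2 * m}. ?c b \<in> T}"
  have "T \<inter> cheap m \<rho> \<subseteq> ?A \<union> ?B \<union> link \<rho> ` J"
    unfolding cheap_def path_edges_def chords_def J_def by fast
  then have "card (T \<inter> cheap m \<rho>) \<le> card (?A \<union> ?B \<union> link \<rho> ` J)"
    by (intro card_mono) (auto simp: finJ)
  also have "\<dots> \<le> card ?A + card ?B + card (link \<rho> ` J)"
    using card_Un_le[of "?A \<union> ?B" "link \<rho> ` J"] card_Un_le[of ?A ?B] by linarith
  also have "card ?A \<le> (\<Sum>g<m. \<Sum>r<9. of_bool (?p g r \<in> T))"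
  proof -
    have "card ?A \<le> card {x \<in> {..<m} \<times> {..<9}. (case x of (g, r) \<Rightarrow> ?p g r \<in> T)}"
      by (intro card_image_le finite_subset[OF Collect_restrict]) auto
    also have "\<dots> = (\<Sum>x\<in>{..<m} \<times> {..<9}. of_bool (case x of (g, r) \<Rightarrow> ?p g r \<in> T))"
      by (simp add: Int_def)
    also have "\<dots> = (\<Sum>g<m. \<Sum>r<9. of_bool (?p g r \<in> T))"
      unfolding sum.cartesian_product by (intro sum.cong) auto
    finally show ?thesis .
  qed
  also have "card ?B \<le> (\<Sum>g<m. of_bool (?c (2 * g) \<in> T) + of_bool (?c (2 * g + 1) \<in> T))"
  proof -
    have "card ?B \<le> card {b \<in> {..<2 * m}. ?c b \<in> T}" by (intro card_image_le) auto
    also have "\<dots> = (\<Sum>b<2 * m. of_bool (?c b \<in> T))" by (simp add: Int_def)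
    finally show ?thesis by (simp only: sum_lessThan_double)
  qed
  also have "card (link \<rho> ` J) \<le> (\<Sum>g<m. of_bool (g \<in> ?W))"
  proof -
    have "card (link \<rho> ` J) \<le> card ?W" using card_image_le[OF finJ, of "link \<rho>"] JW by linarith
    also have "?W = {g \<in> {..<m}. g \<in> ?W}" using W by blast
    finally show ?thesis by (simp add: Int_def)
  qed
  finally have "card (T \<inter> cheap m \<rho>) \<le>
      (\<Sum>g<m. (\<Sum>r<9. of_bool (?p g r \<in> T)) + (of_bool (?c (2 * g) \<in> T) + of_bool (?c (2 * g + 1) \<in> T)
        + of_bool (g \<in> ?W)))"
    by (simp only: sum.distrib add.assoc)
  also have "\<dots> \<le> (\<Sum>g<m. (\<Sum>r<9. of_bool (?p g r \<in> T)) + (\<Sum>r<9. of_bool (?p g r \<notin> T)))"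
    unfolding J_def using sparse_fixpoint_free[OF sp k]
    by (intro sum_mono add_mono order_refl gadget_bound T) auto
  also have "\<dots> = (\<Sum>g<m. \<Sum>r<(9 :: nat). 1)"
    unfolding sum.distrib[symmetric] by (intro sum.cong) auto
  finally show ?thesis by simp
qed

section \<open>The tour through the gadgets in order is locally optimal\<close>

lemma identity_tour:
  "m > 0 \<Longrightarrow> is_tour (10 * m) (cycle_edges (10 * m) id)"
  by (auto simp: is_tour_def intro!: exI[of _ id])

lemma identity_tour_edge_cases:
  assumes "e \<in> cycle_edges (10 * m) id"
  obtains i where "i < 10 * m" "i mod 10 = 9" "e = {i, Suc i mod (10 * m)}"
  | "e \<in> path_edges m"
proof -
  obtain i where i: "i < 10 * m" "e = {i, Suc i mod (10 * m)}"
    using assms by (auto simp: cycle_edges_def)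
  show thesis
  proof (cases "i mod 10 = 9")
    case False
    then have "Suc i \<noteq> 10 * m" by presburger
    then have "Suc i mod (10 * m) = Suc i" using i(1) by simp
    then have "e = {10 * (i div 10) + i mod 10, 10 * (i div 10) + i mod 10 + 1}" using i(2) by simp
    moreover have "i div 10 < m" "i mod 10 < 9" using False i(1) by auto
    ultimately have "e \<in> path_edges m" unfolding path_edges_def by blast
    then show thesis by (rule that(2))
  qed (use i that(1) in blast)
qed

lemma path_edges_subset: "path_edges m \<subseteq> cycle_edges (10 * m) id"
proof
  fix e assume "e \<in> path_edges m"
  then obtain g r where e: "g < m" "r < 9" "e = {10 * g + r, 10 * g + r + 1}" by (auto simp: path_edges_def)
  then have "10 * g + r < 10 * m" "Suc (10 * g + r) mod (10 * m) = 10 * g + r + 1" by simp_all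
  then show "e \<in> cycle_edges (10 * m) id" unfolding e(3) cycle_edges_image id_def by force
qed

lemma card_path_edges: "card (path_edges m) = 9 * m"
proof -
  have "inj_on (\<lambda>(g, r). {10 * g + r, 10 * g + r + 1}) ({..<m} \<times> {..<9 :: nat})"
  proof (rule inj_onI, clarify)
    fix g r g' r' :: nat
    assume "r < 9" "r' < 9" "{10 * g + r, 10 * g + r + 1} = {10 * g' + r', 10 * g' + r' + 1}"
    then show "g = g' \<and> r = r'" by (auto simp: doubleton_eq_iff) presburger+
  qed
  then show ?thesis by (simp add: path_edges_def card_image)
qed

lemma link_notin_identity_tour:
  assumes "\<rho> b \<noteq> b" shows "link \<rho> b \<notin> cycle_edges (10 * m) id"
proof
  assume "link \<rho> b \<in> cycle_edges (10 * m) id"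
  then show False
  proof (cases rule: identity_tour_edge_cases)
    case (1 i)
    then have "i = exit b \<or> i = entry (\<rho> b)" by (auto simp: link_def doubleton_eq_iff)
    then show False using mod_10_exit[of b] mod_10_entry[of "\<rho> b"] 1 by auto
  next
    case 2
    then obtain i where "{exit b, entry (\<rho> b)} = {i, i + 1}" by (auto simp: path_edges_def link_def)
    then have "Suc (entry (\<rho> b)) = exit b \<or> entry (\<rho> b) = Suc (exit b)" by (auto simp: doubleton_eq_iff)
    then show False using assms entry_eq_pred_exit entry_neq_Suc_exit by blast
  qed
qed

lemma identity_tour_Int_cheap:
  assumes "\<And>b. b < 2 * m \<Longrightarrow> \<rho> b \<noteq> b"
  shows "cycle_edges (10 * m) id \<inter> cheap m \<rho> = path_edges m"
proof
  show "path_edges m \<subseteq> cycle_edges (10 * m) id \<inter> cheap m \<rho>"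
    using path_edges_subset by (auto simp: cheap_def)
  show "cycle_edges (10 * m) id \<inter> cheap m \<rho> \<subseteq> path_edges m"
  proof
    fix e assume e: "e \<in> cycle_edges (10 * m) id \<inter> cheap m \<rho>"
    then have "e \<in> cycle_edges (10 * m) id" by blast
    then show "e \<in> path_edges m"
    proof (cases rule: identity_tour_edge_cases)
      case (1 i)
      \<comment> \<open>A join runs from residue 9 to residue 0 modulo 10, also at the wraparound,
        whereas chords pair residues 0 and 4 or 5 and 9.\<close>
      from 1 have i': "Suc i mod (10 * m) mod 10 = 0" by (simp add: mod_mod_cancel mod_Suc)
      have "e \<notin> link \<rho> ` {..<2 * m}" using e assms link_notin_identity_tour by blast
      moreover have "e \<notin> chords m"
      proof
        assume "e \<in> chords m"
        then obtain b where "{i, Suc i mod (10 * m)} = {5 * b, 5 * b + 4}"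
          using 1 by (auto simp: chords_def)
        then have "i = 5 * b \<and> Suc i mod (10 * m) = 5 * b + 4 \<or> i = 5 * b + 4 \<and> Suc i mod (10 * m) = 5 * b"
          by (auto simp: doubleton_eq_iff)
        then show False
        proof
          assume "i = 5 * b \<and> Suc i mod (10 * m) = 5 * b + 4"
          then have "5 * b mod 10 = 9" using 1(2) by simp
          then show False by presburger
        next
          assume *: "i = 5 * b + 4 \<and> Suc i mod (10 * m) = 5 * b"
          then have "(5 * b + 4) mod 10 = 9" "5 * b mod 10 = 0" using 1(2) i' by auto
          then show False by presburger
        qed
      qed
      ultimately show ?thesis using e by (auto simp: cheap_def)
    qed
  qed
qed

text \<open>A move adds as many edges as it removes, and no link lies on the identity tour. The new
  tour thus has at most \<open>k\<close> links, so the bound of \<open>9 * m\<close> cheap edges,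
  attained by the identity tour, applies to it.\<close>

lemma identity_tour_optimal:
  assumes m: "m > 0" and sp: "sparse m \<rho> k" and k: "k > 0"
  shows "k_optimal (10 * m) (cost m \<rho>) k (cycle_edges (10 * m) id)"
    and "tour_cost (cost m \<rho>) (cycle_edges (10 * m) id) = 11 * m"
proof -
  let ?T = "cycle_edges (10 * m) id"
  have fpf: "\<rho> b \<noteq> b" if "b < 2 * m" for b using sparse_fixpoint_free[OF sp k that] .
  have T: "is_tour (10 * m) ?T" using m by (rule identity_tour)
  show cost_T: "tour_cost (cost m \<rho>) ?T = 11 * m"
    using tour_cost_eq[OF T, of m \<rho>] identity_tour_Int_cheap[of m \<rho>] fpf by (simp add: card_path_edges)
  have "11 * m \<le> tour_cost (cost m \<rho>) T'" if "k_move (10 * m) k ?T T'" for T'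
  proof -
    have T': "is_tour (10 * m) T'" and diff: "card (?T - T') \<le> k" using that by (auto simp: k_move_def)
    have "card (T' - ?T) = card (?T - T')"
      using tour_card[OF T] tour_card[OF T'] tour_finite[OF T] tour_finite[OF T']
      by (metis card_Diff_subset_Int finite_Int inf_commute)
    define J where "J = {b. b < 2 * m \<and> link \<rho> b \<in> T'}"
    \<comment> \<open>\<open>J\<close> counts indices while a move counts edges, so distinct indices
      must give distinct links.\<close>
    have "inj_on (link \<rho>) J"
    proof (rule inj_onI)
      fix b b' assume "link \<rho> b = link \<rho> b'"
      then consider "exit b = exit b'" | "exit b = entry (\<rho> b')"
        by (auto simp: link_def doubleton_eq_iff)
      then show "b = b'"
      proof cases
        case 1 then show ?thesis by (metis div_5_exit)
      next
        case 2 then show ?thesis using mod_10_exit[of b] mod_10_entry[of "\<rho> b'"] by auto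
      qed
    qed
    then have "card J = card (link \<rho> ` J)" by (simp add: card_image)
    also have "\<dots> \<le> card (T' - ?T)"
      using link_notin_identity_tour fpf tour_finite[OF T'] by (intro card_mono) (auto simp: J_def)
    finally have "card J \<le> k" using diff \<open>card (T' - ?T) = card (?T - T')\<close> by simp
    then have "card (T' \<inter> cheap m \<rho>) \<le> 9 * m"
      using card_cheap_in_tour_le[OF T' sp k] by (simp add: J_def)
    then show ?thesis using tour_cost_eq[OF T', of m \<rho>] by linarith
  qed
  then show "k_optimal (10 * m) (cost m \<rho>) k ?T"
    using T by (auto simp: k_optimal_def cost_T not_less)
qed

section \<open>A cheap tour along the links\<close>

text \<open>Walks once around the 5-cycle of block \<^term>\<open>b\<close>, from its entry to its exit.\<close>

definition pos :: "nat \<Rightarrow> nat \<Rightarrow> nat" where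
  "pos b i = 5 * b + (arm b + 5 - i) mod 5"

lemma pos_less: "pos b i < 5 * b + 5"
  by (simp add: pos_def)

lemma pos_div: "pos b i div 5 = b"
  by (simp add: pos_def)

lemma pos_inj:
  assumes "i < 5" "j < 5" "pos b i = pos b j" shows "i = j"
proof -
  have "i \<in> {0, 1, 2, 3, 4}" "j \<in> {0, 1, 2, 3, 4}" using assms by auto
  then show ?thesis using assms(3) by (auto simp: pos_def arm_def split: if_splits)
qed

lemma pos_0: "pos b 0 = entry b" and pos_4: "pos b 4 = exit b"
  by (simp_all add: pos_def entry_def exit_def arm_def)

lemma pos_step_cheap:
  assumes "b < 2 * m" "i < 4" shows "{pos b i, pos b (Suc i)} \<in> cheap m \<rho>"
proof -
  \<comment> \<open>The walk goes downward, and its wrap from offset 0 to offset 4 is the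
    chord.\<close>
  have "i \<in> {0, 1, 2, 3}" using assms(2) by auto
  then have "pos b i = 5 * b \<and> pos b (Suc i) = 5 * b + 4
      \<or> (\<exists>r<4. pos b i = 5 * b + r + 1 \<and> pos b (Suc i) = 5 * b + r)"
    by (cases "even b") (auto simp: pos_def arm_def)
  then consider "pos b i = 5 * b" "pos b (Suc i) = 5 * b + 4"
    | r where "r < 4" "pos b i = 5 * b + r + 1" "pos b (Suc i) = 5 * b + r"
    by blast
  then show ?thesis
  proof cases
    case 1
    then show ?thesis using assms(1) by (auto simp: cheap_def chords_def)
  next
    case 2
    obtain g s where gs: "b = 2 * g + s" "s < 2" by (metis mult_div_mod_eq mod_less_divisor zero_less_numeral)
    have "{pos b i, pos b (Suc i)} = {10 * g + (5 * s + r), 10 * g + (5 * s + r) + 1}"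
      using 2 gs(1) by (auto simp: algebra_simps)
    moreover have "g < m" "5 * s + r < 9" using gs 2(1) assms(1) by auto
    ultimately show ?thesis unfolding cheap_def path_edges_def by blast
  qed
qed

text \<open>The walks around the blocks are concatenated in the order of \<open>xs\<close>. Where
  \<open>\<rho>\<close> leads from a block to the next one, the connecting edge is a link, so only
  breaks can cost 2.\<close>

lemma OPT_le_breaks:
  assumes m: "m > 0" and xs: "distinct xs" "set xs = {..<2 * m}"
  shows "OPT (10 * m) (cost m \<rho>) \<le> 10 * m + card (breaks \<rho> xs)"
proof -
  have len: "length xs = 2 * m" using distinct_card[OF xs(1)] xs(2) by simp
  define p where "p x = pos (xs ! (x div 5)) (x mod 5)" for x
  have nth: "xs ! j < 2 * m" if "j < 2 * m" for j
    using nth_mem[of j xs] that len xs(2) by auto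
  have "inj_on p {..<10 * m}"
  proof (rule inj_onI)
    fix x y assume xy: "x \<in> {..<10 * m}" "y \<in> {..<10 * m}" "p x = p y"
    then have "xs ! (x div 5) = xs ! (y div 5)" using pos_div by (metis p_def)
    then have d: "x div 5 = y div 5" using xy(1,2) nth_eq_iff_index_eq[OF xs(1)] len by simp
    then have "x mod 5 = y mod 5" using xy(3) pos_inj unfolding p_def by (metis mod_less_divisor zero_less_numeral)
    with d show "x = y" by (metis mult_div_mod_eq)
  qed
  moreover have "p ` {..<10 * m} \<subseteq> {..<10 * m}"
  proof
    fix y assume "y \<in> p ` {..<10 * m}"
    then obtain x where "x < 10 * m" "y = p x" by blast
    moreover from this have "xs ! (x div 5) < 2 * m" by (intro nth) simp
    ultimately show "y \<in> {..<10 * m}" using pos_less[of "xs ! (x div 5)" "x mod 5"] by (simp add: p_def)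
  qed
  ultimately have "bij_betw p {..<10 * m} {..<10 * m}" by (simp add: bij_betw_def endo_inj_surj)
  then have tour: "is_tour (10 * m) (cycle_edges (10 * m) p)"
    using m by (auto simp: is_tour_def)
  \<comment> \<open>Positions of the last vertices of blocks at breaks. The last index of
    \<open>xs\<close> is among the breaks, which covers the closing edge.\<close>
  let ?D = "(\<lambda>j. 5 * j + 4) ` breaks \<rho> xs"
  have edge: "cost m \<rho> {p x, p (Suc x mod (10 * m))} \<le> 1 + of_bool (x \<in> ?D)" if x: "x < 10 * m" for x
  proof (cases "x mod 5 = 4")
    case False
    then have "Suc x \<noteq> 10 * m" by presburger
    then have "Suc x mod (10 * m) = Suc x" using x by simp
    moreover have "Suc x div 5 = x div 5" "Suc x mod 5 = Suc (x mod 5)" using False by presburger+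
    moreover have "x mod 5 < 4" using False by presburger
    ultimately have "{p x, p (Suc x mod (10 * m))} \<in> cheap m \<rho>"
      using pos_step_cheap[of "xs ! (x div 5)" m "x mod 5"] nth[of "x div 5"] x by (simp add: p_def)
    then show ?thesis by (simp add: cost_def)
  next
    case True
    show ?thesis
    proof (cases "x \<in> ?D")
      case False
      define j where "j = x div 5"
      have xj: "x = 5 * j + 4" using True by (simp add: j_def) presburger
      have j: "j < length xs" using x xj len by simp
      moreover have "j \<notin> breaks \<rho> xs" using False xj by blast
      ultimately have next_block: "Suc j < length xs" "xs ! Suc j = \<rho> (xs ! j)" by (auto simp: breaks_def)
      then have "Suc x mod (10 * m) = 5 * Suc j" using xj len by simp
      then have "p (Suc x mod (10 * m)) = entry (\<rho> (xs ! j))" using next_block by (simp add: p_def pos_0)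
      moreover have "p x = exit (xs ! j)" using xj by (simp add: p_def pos_4)
      ultimately have "{p x, p (Suc x mod (10 * m))} = link \<rho> (xs ! j)" by (simp add: link_def)
      moreover have "xs ! j < 2 * m" using nth j len by simp
      ultimately have "{p x, p (Suc x mod (10 * m))} \<in> cheap m \<rho>" by (auto simp: cheap_def)
      then show ?thesis by (simp add: cost_def)
    qed (simp add: cost_def)
  qed
  have "OPT (10 * m) (cost m \<rho>) \<le> tour_cost (cost m \<rho>) (cycle_edges (10 * m) p)"
    using tour by (rule OPT_le)
  also have "\<dots> \<le> (\<Sum>x<10 * m. cost m \<rho> {p x, p (Suc x mod (10 * m))})"
    unfolding tour_cost_def cycle_edges_image using sum_image_le[of "{..<10 * m}" "cost m \<rho>"] by simp
  also have "\<dots> \<le> (\<Sum>x<10 * m. 1 + of_bool (x \<in> ?D))" using edge by (intro sum_mono) simp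
  also have "\<dots> = 10 * m + card ({..<10 * m} \<inter> ?D)"
    unfolding sum.distrib by simp
  also have "card ({..<10 * m} \<inter> ?D) \<le> card ?D" by (intro card_mono) (auto simp: finite_breaks)
  also have "card ?D \<le> card (breaks \<rho> xs)" by (rule card_image_le[OF finite_breaks])
  finally show ?thesis by simp
qed

section \<open>The ratio\<close>

lemma k_optimal_mono: "k_optimal n c k' T \<Longrightarrow> k \<le> k' \<Longrightarrow> k_optimal n c k T"
  by (auto simp: k_optimal_def k_move_def)

theorem theorem8p7:
  fixes k :: nat and \<epsilon> :: real
  assumes "k \<ge> 2" and "\<epsilon> > 0"
  shows "\<exists>n c T. tsp12 n c \<and> k_optimal n c k T \<and>
           real (tour_cost c T) \<ge> (11/10 - \<epsilon>) * real (OPT n c)"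
proof -
  \<comment> \<open>\<open>K \<ge> k\<close> gives \<open>k\<close>-optimality, and
    \<open>K \<ge> 1 / \<epsilon>\<close> bounds the breaks, at most \<open>2 * m / K\<close>, by
    \<open>2 * \<epsilon> * m\<close>.\<close>
  define K where "K = max k (nat \<lceil>1 / \<epsilon>\<rceil>)"
  have K: "K > 0" "k \<le> K" using assms(1) by (auto simp: K_def)
  have "1 / \<epsilon> \<le> real K" unfolding K_def by linarith
  then have eK: "1 \<le> \<epsilon> * real K" using assms(2) by (simp add: field_simps)
  obtain m \<rho> where m: "m > 0" and sp: "sparse m \<rho> K" using ex_sparse by blast
  have \<rho>: "\<rho> permutes {..<2 * m}" using sp by (simp add: sparse_def)
  have "\<exists>xs. distinct xs \<and> set xs = {..<2 * m} \<and> K * card (breaks \<rho> xs) \<le> card {..<2 * m}"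
  proof (rule ex_enumeration_few_breaks[OF \<rho>])
    show "(\<rho> ^^ i) b \<noteq> b" if "b \<in> {..<2 * m}" "0 < i" "i \<le> K" for b i
      using sparse_no_short_orbit[OF sp] that by simp
    show "\<rho> ` {..<2 * m} \<subseteq> {..<2 * m}" using permutes_image[OF \<rho>] by simp
  qed auto
  then obtain xs where xs: "distinct xs" "set xs = {..<2 * m}" "K * card (breaks \<rho> xs) \<le> 2 * m" by auto
  let ?n = "10 * m" and ?c = "cost m \<rho>" and ?d = "card (breaks \<rho> xs)"
  let ?T = "cycle_edges ?n id"
  have OPT: "OPT ?n ?c \<le> 10 * m + ?d" using OPT_le_breaks[OF m xs(1,2)] .
  have "real ?d \<le> \<epsilon> * real K * real ?d" using eK by (simp add: mult_le_cancel_right1)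
  also have "\<dots> = \<epsilon> * real (K * ?d)" by simp
  also have "\<dots> \<le> \<epsilon> * real (2 * m)"
    using assms(2) xs(3) by (intro mult_left_mono of_nat_mono) simp_all
  finally have d: "real ?d \<le> 2 * \<epsilon> * real m" by simp
  have "(11/10 - \<epsilon>) * real (OPT ?n ?c) \<le> 11 * real m"
  proof (cases "11/10 - \<epsilon> \<ge> 0")
    case True
    have "(11/10 - \<epsilon>) * real (OPT ?n ?c) \<le> (11/10 - \<epsilon>) * (10 * real m + 2 * \<epsilon> * real m)"
      using OPT d True by (intro mult_left_mono) linarith+
    \<comment> \<open>The linear terms combine as 2.2 - 10 = -7.8, so the slack in the optimum is
      absorbed.\<close>
    also have "\<dots> = (11 - (7.8 * \<epsilon> + 2 * \<epsilon>\<^sup>2)) * real m"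
      by (simp add: algebra_simps power2_eq_square)
    also have "\<dots> \<le> 11 * real m"
      using assms(2) zero_le_power2[of \<epsilon>] by (intro mult_right_mono) linarith+
    finally show ?thesis .
  next
    case False
    then have "(11/10 - \<epsilon>) * real (OPT ?n ?c) \<le> 0" by (intro mult_nonpos_nonneg) simp_all
    then show ?thesis by (rule order_trans) simp
  qed
  moreover have "tsp12 ?n ?c" by (simp add: tsp12_def cost_def)
  moreover have "k_optimal ?n ?c k ?T"
    using identity_tour_optimal(1)[OF m sp K(1)] K(2) by (rule k_optimal_mono)
  moreover have "tour_cost ?c ?T = 11 * m" using identity_tour_optimal(2)[OF m sp K(1)] .
  ultimately show ?thesis by (intro exI[of _ ?n] exI[of _ ?c] exI[of _ ?T]) simp
qed

end
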